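(* Among all graphs with exactly $5$ vertices, the complete bipartite graph $K_{2,3}$ is the unique graph (up to isomorphism) that contains a cycle, has an outside-obstacle representation, and has no inside-obstacle representation.
   Context: An obstacle is a topologically open, non-self-intersecting polygonal region in the plane (possibly unbounded). Given an obstacle $C$ and a finite set $P$ of points in general position in the complement of $C$, the visibility graph $G_C(P)$ has vertex set $P$ and an edge $pq$ exactly when $\overline{pq}\cap C=\emptyset$; its straight-line drawing is the visibility drawing. A single-obstacle representation of $G$ is a pair $(P,C)$ with $G\cong G_C(P)$; it is an outside-obstacle representation if $C$ lies in the unbounded component of the complement of the visibility drawing, and an inside-obstacle representation if $C$ lies in the complement of that unbounded component. *)

theory Defs
  imports "HOL-Analysis.Analysis"
begin

type_synonym point = "real^2"

definition ray :: "point \<Rightarrow> point \<Rightarrow> point set" where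
  "ray a d = {a + t *\<^sub>R d | t. t \<ge> 0}"

definition polygonal_set :: "point set \<Rightarrow> bool" where
  "polygonal_set S \<longleftrightarrow> (\<exists>F. finite F \<and> S = \<Union>F \<and>
      (\<forall>X\<in>F. (\<exists>a b. X = closed_segment a b) \<or> (\<exists>a d. d \<noteq> 0 \<and> X = ray a d)))"

text \<open>An obstacle: a nonempty, open, connected region whose boundary is a non-self-intersecting
  polygonal curve, i.e. either a simple closed polygon (bounded or co-bounded region) or a simple
  bi-infinite polygonal chain (homeomorphic to the real line; unbounded region).\<close>
definition obstacle :: "point set \<Rightarrow> bool" where
  "obstacle C \<longleftrightarrow> open C \<and> connected C \<and> C \<noteq> {} \<and> polygonal_set (frontier C) \<and>
     ((\<exists>g. simple_path g \<and> pathfinish g = pathstart g \<and> path_image g = frontier C) \<or>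
      frontier C homeomorphic (UNIV :: real set))"

definition general_position :: "point set \<Rightarrow> bool" where
  "general_position P \<longleftrightarrow>
     (\<forall>a\<in>P. \<forall>b\<in>P. \<forall>c\<in>P. a \<noteq> b \<and> a \<noteq> c \<and> b \<noteq> c \<longrightarrow> \<not> collinear {a, b, c})"

definition visible :: "point set \<Rightarrow> point \<Rightarrow> point \<Rightarrow> bool" where
  "visible C p q \<longleftrightarrow> p \<noteq> q \<and> closed_segment p q \<inter> C = {}"

definition vis_drawing :: "point set \<Rightarrow> point set \<Rightarrow> point set" where
  "vis_drawing P C = P \<union> \<Union>{closed_segment p q | p q. p \<in> P \<and> q \<in> P \<and> visible C p q}"

definition graph :: "'a set \<Rightarrow> ('a \<Rightarrow> 'a \<Rightarrow> bool) \<Rightarrow> bool" where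
  "graph V E \<longleftrightarrow> finite V \<and> (\<forall>u v. E u v \<longrightarrow> u \<in> V \<and> v \<in> V) \<and>
     (\<forall>u v. E u v \<longrightarrow> E v u) \<and> (\<forall>u. \<not> E u u)"

definition graph_iso :: "'a set \<Rightarrow> ('a \<Rightarrow> 'a \<Rightarrow> bool) \<Rightarrow> 'b set \<Rightarrow> ('b \<Rightarrow> 'b \<Rightarrow> bool) \<Rightarrow> bool" where
  "graph_iso V E V' E' \<longleftrightarrow>
     (\<exists>f. bij_betw f V V' \<and> (\<forall>u\<in>V. \<forall>v\<in>V. E u v \<longleftrightarrow> E' (f u) (f v)))"

definition has_cycle :: "'a set \<Rightarrow> ('a \<Rightarrow> 'a \<Rightarrow> bool) \<Rightarrow> bool" where
  "has_cycle V E \<longleftrightarrow> (\<exists>vs. length vs \<ge> 3 \<and> distinct vs \<and> set vs \<subseteq> V \<and>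
     (\<forall>i < length vs. E (vs ! i) (vs ! ((i + 1) mod length vs))))"

definition K23_V :: "nat set" where "K23_V = {0..<5}"
definition K23_E :: "nat \<Rightarrow> nat \<Rightarrow> bool" where
  "K23_E u v \<longleftrightarrow> (u \<in> {0,1} \<and> v \<in> {2,3,4}) \<or> (v \<in> {0,1} \<and> u \<in> {2,3,4})"

definition single_obstacle_rep :: "'a set \<Rightarrow> ('a \<Rightarrow> 'a \<Rightarrow> bool) \<Rightarrow> point set \<Rightarrow> point set \<Rightarrow> bool" where
  "single_obstacle_rep V E P C \<longleftrightarrow> obstacle C \<and> finite P \<and> P \<inter> C = {} \<and> general_position P \<and>
     graph_iso V E P (visible C)"

definition outside_obstacle_rep :: "'a set \<Rightarrow> ('a \<Rightarrow> 'a \<Rightarrow> bool) \<Rightarrow> point set \<Rightarrow> point set \<Rightarrow> bool" where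
  "outside_obstacle_rep V E P C \<longleftrightarrow> single_obstacle_rep V E P C \<and> C \<subseteq> outside (vis_drawing P C)"

definition inside_obstacle_rep :: "'a set \<Rightarrow> ('a \<Rightarrow> 'a \<Rightarrow> bool) \<Rightarrow> point set \<Rightarrow> point set \<Rightarrow> bool" where
  "inside_obstacle_rep V E P C \<longleftrightarrow> single_obstacle_rep V E P C \<and> C \<inter> outside (vis_drawing P C) = {}"

end

theory Submission
  imports Defs
begin

text \<open>Inside representations of $K_{2,3}$: let $u, v$ be the two vertices of degree three. Two of the
  other three vertices, say $x$ and $y$, lie on the same side of the line $uv$. The drawing meets
  this line only in $u$ and $v$, so an inside obstacle meets it only between them. Being connected,
  the obstacle cannot leave, on that side, the intersection of the triangles $uvx$ and $uvy$, and
  this intersection misses the segment $xy$, which therefore remains unblocked.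

  For the positive statements all obstacles have the form $\{(s,t) : 0 < t < f(s)\}$ with $f$
  piecewise linear, so that blocking and visibility become linear arithmetic. An inside obstacle is
  enclosed by a second such region whose boundary consists of edges of the drawing; the obstacle for
  the outside representation of $K_{2,3}$ lies below the whole drawing.\<close>

section \<open>Regions under the graph of a function\<close>

text \<open>Uniqueness means that a five-vertex graph with a cycle and without an inside
  representation is K_{2,3}. The vertices are listed with a cycle in front, which turns the graph
  into ten bits. Behind a triangle the seven free bits allow 128 lists; permuting the triangle and
  exchanging the other two vertices group them into 26 classes, and one representation per class
  excludes triangles. In a triangle-free graph a five-cycle has no chord, and next to a four-cycle
  the fifth vertex is isolated, pendant, or joined to two opposite vertices. The last case is
  K_{2,3}; the other three need one representation each. So 29 drawings have to be certified, each
  by plain computation. A blocked pair asks for a point of its segment inside the obstacle; the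
  coordinates are such that the midpoint always serves. A visible pair asks for inequalities in a
  single real parameter.\<close>

lemma continuous_on_vector_2 [continuous_intros]:
  assumes "continuous_on S f" and "continuous_on S g"
  shows "continuous_on S (\<lambda>x. vector [f x, g x] :: real^2)"
proof -
  have "(\<lambda>x. vector [f x, g x] :: real^2) = (\<lambda>x. \<chi> i. if i = 1 then f x else g x)"
    by (auto simp: fun_eq_iff vec_eq_iff forall_2)
  moreover have "continuous_on S (\<lambda>x. if i = 1 then f x else g x)" for i :: 2
    using assms by (cases "i = 1") auto
  ultimately show ?thesis
    by (simp only: continuous_on_vec_lambda)
qed

lemma point_eq_iff: "(p :: point) = q \<longleftrightarrow> p$1 = q$1 \<and> p$2 = q$2"
  by (simp add: vec_eq_iff forall_2)

lemma vector_2_eta [simp]: "vector [p$1, p$2] = (p :: point)"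
  by (simp add: point_eq_iff)

definition hump :: "(real \<Rightarrow> real) \<Rightarrow> point set" where
  "hump f = {p. 0 < p$2 \<and> p$2 < f (p$1)}"

locale hump_profile =
  fixes f :: "real \<Rightarrow> real" and a b :: real
  assumes ab: "a < b"
    and cont: "continuous_on UNIV f"
    and pos: "\<And>s. a < s \<Longrightarrow> s < b \<Longrightarrow> 0 < f s"
    and ends: "f a = 0" "f b = 0"
    and nonpos: "\<And>s. s < a \<or> b < s \<Longrightarrow> f s \<le> 0"
begin

lemma pos_iff: "0 < f s \<longleftrightarrow> a < s \<and> s < b"
  using pos[of s] nonpos[of s] ends by (metis less_irrefl linorder_neqE_linordered_idom not_le)

lemma open_hump: "open (hump f)"
proof -
  have "continuous_on UNIV (\<lambda>p::point. f (p$1))"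
    by (rule continuous_on_compose2[OF cont]) (auto intro: continuous_intros)
  then show ?thesis
    unfolding hump_def by (intro open_Collect_conj open_Collect_less continuous_intros)
qed

text \<open>Scaling every vertical fibre to the unit interval exhibits the hump as a continuous
  image of a rectangle, from which connectedness and boundedness follow.\<close>

lemma hump_image: "hump f = (\<lambda>(s, r). vector [s, r * f s]) ` ({a<..<b} \<times> {0<..<1})"
proof (intro equalityI subsetI)
  fix p assume "p \<in> hump f"
  then have p: "0 < p$2" "p$2 < f (p$1)" by (auto simp: hump_def)
  then have "0 < f (p$1)" by linarith
  then have "p = vector [p$1, (p$2 / f (p$1)) * f (p$1)]" "0 < p$2 / f (p$1)" "p$2 / f (p$1) < 1"
    "a < p$1" "p$1 < b"
    using p pos_iff[of "p$1"] by auto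
  then show "p \<in> (\<lambda>(s, r). vector [s, r * f s]) ` ({a<..<b} \<times> {0<..<1})"
    by (intro image_eqI[of _ _ "(p$1, p$2 / f (p$1))"]) auto
next
  fix p assume "p \<in> (\<lambda>(s, r). vector [s, r * f s] :: point) ` ({a<..<b} \<times> {0<..<1})"
  then show "p \<in> hump f"
    using pos by (auto simp: hump_def)
qed

lemma connected_hump: "connected (hump f)"
  unfolding hump_image
proof (rule connected_continuous_image)
  have "continuous_on ({a<..<b} \<times> {0<..<1}) (\<lambda>z::real\<times>real. f (fst z))"
    by (rule continuous_on_compose2[OF cont]) (auto intro: continuous_intros)
  then show "continuous_on ({a<..<b} \<times> {0<..<1}) (\<lambda>(s, r). vector [s, r * f s] :: real^2)"
    unfolding case_prod_unfold by (intro continuous_intros)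
  show "connected ({a<..<b} \<times> {0<..<1::real})"
    by (simp add: connected_Times)
qed

lemma hump_nonempty: "hump f \<noteq> {}"
  unfolding hump_image using ab by auto

lemma bounded_hump: "bounded (hump f)"
proof -
  have "compact ((\<lambda>(s, r). vector [s, r * f s] :: real^2) ` ({a..b} \<times> {0..1}))"
  proof (rule compact_continuous_image)
    have "continuous_on ({a..b} \<times> {0..1}) (\<lambda>z::real\<times>real. f (fst z))"
      by (rule continuous_on_compose2[OF cont]) (auto intro: continuous_intros)
    then show "continuous_on ({a..b} \<times> {0..1}) (\<lambda>(s, r). vector [s, r * f s] :: real^2)"
      unfolding case_prod_unfold by (intro continuous_intros)
  qed (auto intro: compact_Times)
  then show ?thesis
    by (rule bounded_subset[OF compact_imp_bounded]) (auto simp: hump_image intro!: image_mono)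
qed

lemma frontier_hump:
  "frontier (hump f) =
     (\<lambda>s. vector [s, 0]) ` {a..b} \<union> (\<lambda>s. vector [s, f s]) ` {a..b}" (is "_ = ?B \<union> ?G")
proof
  have cf: "continuous_on UNIV (\<lambda>p::point. f (p$1))"
    by (rule continuous_on_compose2[OF cont]) (auto intro: continuous_intros)
  have "closed {p::point. a \<le> p$1 \<and> p$1 \<le> b \<and> 0 \<le> p$2 \<and> p$2 \<le> f (p$1)}"
    by (intro closed_Collect_conj closed_Collect_le continuous_intros cf)
  then have "closure (hump f) \<subseteq> {p. a \<le> p$1 \<and> p$1 \<le> b \<and> 0 \<le> p$2 \<and> p$2 \<le> f (p$1)}"
    using pos by (intro closure_minimal) (auto simp: hump_image less_imp_le mult_left_le_one_le)
  then have "frontier (hump f) \<subseteq> {p. a \<le> p$1 \<and> p$1 \<le> b \<and> (p$2 = 0 \<or> p$2 = f (p$1))}"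
    using open_hump by (auto simp: frontier_def hump_def interior_open)
  also have "\<dots> \<subseteq> ?B \<union> ?G"
  proof
    fix p :: point assume "p \<in> {p. a \<le> p$1 \<and> p$1 \<le> b \<and> (p$2 = 0 \<or> p$2 = f (p$1))}"
    then have "p$1 \<in> {a..b}" "p = vector [p$1, 0] \<or> p = vector [p$1, f (p$1)]"
      by (auto simp: point_eq_iff)
    then show "p \<in> ?B \<union> ?G" by blast
  qed
  finally show "frontier (hump f) \<subseteq> ?B \<union> ?G" .
next
  \<comment> \<open>The parametrization is continuous on the closed rectangle too, so it maps that
    rectangle into the closure of the hump; \<open>r = 0\<close> yields the base and
    \<open>r = 1\<close> the graph.\<close>
  have c: "vector [s, r * f s] \<in> closure (hump f)" if "s \<in> {a..b}" "r \<in> {0..1}" for s r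
  proof -
    let ?g = "\<lambda>z::real\<times>real. vector [fst z, snd z * f (fst z)] :: real^2"
    have "continuous_on UNIV (\<lambda>z::real\<times>real. f (fst z))"
      by (rule continuous_on_compose2[OF cont]) (auto intro: continuous_intros)
    then have "continuous_on (closure ({a<..<b} \<times> {0<..<1})) ?g"
      by (intro continuous_intros) (auto intro: continuous_on_subset)
    then have "?g ` closure ({a<..<b} \<times> {0<..<1}) \<subseteq> closure (hump f)"
      using pos by (intro image_closure_subset) (auto simp: hump_def intro!: closure_subset[THEN subsetD])
    moreover have "(s, r) \<in> closure ({a<..<b} \<times> {0<..<1})"
      using that ab by (simp add: closure_Times)
    ultimately have "?g (s, r) \<in> closure (hump f)" by blast
    then show ?thesis by simp
  qed
  have "?B \<union> ?G \<subseteq> closure (hump f)"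
    using c[of _ 0] c[of _ 1] by auto
  then show "?B \<union> ?G \<subseteq> frontier (hump f)"
    using open_hump by (auto simp: frontier_def interior_open hump_def)
qed

lemma base_eq_segment:
  "(\<lambda>s. vector [s, 0]) ` {a..b} = closed_segment (vector [a, 0]) (vector [b, 0] :: point)"
proof -
  have "(\<lambda>s. vector [s, 0]) ` {a..b} = (\<lambda>s. vector [s, 0] :: point) ` closed_segment a b"
    using ab by (simp add: closed_segment_eq_real_ivl)
  also have "\<dots> = closed_segment (vector [a, 0]) (vector [b, 0])"
    by (rule closed_segment_linear_image[symmetric]) (auto intro!: linearI simp: point_eq_iff)
  finally show ?thesis .
qed

lemma frontier_hump_simple_closed:
  "\<exists>g. simple_path g \<and> pathfinish g = pathstart g \<and> path_image g = frontier (hump f)"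
proof -
  \<comment> \<open>\<open>g2\<close> runs through the graph backwards, from \<open>b\<close> to
    \<open>a\<close>, so that the two arcs join to a loop. On \<open>{a..b}\<close> the profile
    vanishes only at the ends, which keeps the loop simple.\<close>
  define g1 g2 where "g1 = linepath (vector [a, 0] :: point) (vector [b, 0])"
    and "g2 = (\<lambda>r. vector [b + r * (a - b), f (b + r * (a - b))] :: point)"
  have i1: "path_image g1 = (\<lambda>s. vector [s, 0]) ` {a..b}"
    by (simp add: g1_def base_eq_segment)
  have "(\<lambda>r. b + r * (a - b)) ` {0..1} = closed_segment b a"
    unfolding closed_segment_image_interval by (intro image_cong) (auto simp: algebra_simps)
  moreover have "path_image g2 = (\<lambda>s. vector [s, f s]) ` (\<lambda>r. b + r * (a - b)) ` {0..1}"
    by (simp add: path_image_def g2_def image_image)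
  ultimately have i2: "path_image g2 = (\<lambda>s. vector [s, f s]) ` {a..b}"
    using ab by (simp add: closed_segment_eq_real_ivl)
  have a1: "arc g1"
    using ab by (auto simp: g1_def point_eq_iff intro!: arc_linepath)
  have "continuous_on {0..1} (\<lambda>r. f (b + r * (a - b)))"
    by (rule continuous_on_compose2[OF cont]) (auto intro!: continuous_intros)
  then have a2: "arc g2"
    using ab unfolding arc_def path_def g2_def
    by (intro conjI continuous_intros) (auto simp: inj_on_def point_eq_iff)
  have st: "pathstart g1 = vector [a, 0]" "pathfinish g1 = vector [b, 0]"
    "pathstart g2 = vector [b, 0]" "pathfinish g2 = vector [a, 0]"
    using ends by (auto simp: g1_def g2_def pathstart_def pathfinish_def linepath_def)
  have "path_image g1 \<inter> path_image g2 \<subseteq> {pathstart g1, pathstart g2}"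
  proof
    fix p assume "p \<in> path_image g1 \<inter> path_image g2"
    then have "p$1 \<in> {a..b}" "p$2 = 0" "f (p$1) = 0"
      unfolding i1 i2 by (auto simp: point_eq_iff)
    then have "p$1 = a \<or> p$1 = b"
      using pos_iff[of "p$1"] by auto
    then show "p \<in> {pathstart g1, pathstart g2}"
      using \<open>p$2 = 0\<close> by (auto simp: st point_eq_iff)
  qed
  then have "simple_path (g1 +++ g2)"
    using a1 a2 st by (intro simple_path_join_loop) auto
  moreover have "path_image (g1 +++ g2) = frontier (hump f)"
    by (simp add: path_image_join st i1 i2 frontier_hump)
  ultimately show ?thesis
    using st by (intro exI[of _ "g1 +++ g2"]) simp
qed

end

section \<open>Piecewise linear profiles\<close>

abbreviation pt :: "real \<times> real \<Rightarrow> point" where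
  "pt z \<equiv> vector [fst z, snd z]"

text \<open>Before its first vertex the interpolant continues the first piece, after its last vertex it is
  constant. For a chain that starts and ends at height zero and is positive in between it is
  therefore nonpositive outside the range of the chain, so its hump needs no further bounds.\<close>

fun pl :: "(real \<times> real) list \<Rightarrow> real \<Rightarrow> real" where
  "pl [] s = 0"
| "pl [p] s = snd p"
| "pl (p # q # r) s =
     (if s \<le> fst q then snd p + (s - fst p) * ((snd q - snd p) / (fst q - fst p)) else pl (q # r) s)"

abbreviation x_sorted :: "(real \<times> real) list \<Rightarrow> bool" where
  "x_sorted \<equiv> sorted_wrt (\<lambda>p q. fst p < fst q)"

text \<open>\<open>butlast (tl ch)\<close> consists of the inner vertices. At least one is required,
  as two vertices at height zero alone would give an empty region.\<close>

definition hump_chain :: "(real \<times> real) list \<Rightarrow> bool" where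
  "hump_chain ch \<longleftrightarrow> length ch \<ge> 3 \<and> x_sorted ch \<and> snd (hd ch) = 0 \<and> snd (last ch) = 0 \<and>
     (\<forall>p\<in>set (butlast (tl ch)). 0 < snd p)"

lemma pl_hd: "x_sorted (q # r) \<Longrightarrow> pl (q # r) (fst q) = snd q"
  by (cases r) auto

lemma x_sorted_hd_le_last: "x_sorted (q # r) \<Longrightarrow> fst q \<le> fst (last (q # r))"
  by (cases r rule: rev_cases) (auto simp: less_imp_le)

text \<open>Adds the breakpoint \<open>s = fst q\<close>, at which \<open>pl\<close> still evaluates
  the left piece; both pieces have the value \<open>snd q\<close> there.\<close>

lemma pl_right: "x_sorted (p # q # r) \<Longrightarrow> fst q \<le> s \<Longrightarrow> pl (p # q # r) s = pl (q # r) s"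
  using pl_hd[of q r] by (cases "s = fst q") (auto simp del: pl.simps(2))

lemma pl_last: "x_sorted ch \<Longrightarrow> ch \<noteq> [] \<Longrightarrow> fst (last ch) \<le> s \<Longrightarrow> pl ch s = snd (last ch)"
proof (induction ch rule: induct_list012)
  case (3 p q r)
  then have "fst q \<le> s"
    using x_sorted_hd_le_last[of q r] by simp
  then have "pl (p # q # r) s = pl (q # r) s" by (rule pl_right[OF 3(3)])
  then show ?case using 3 by (simp del: pl.simps)
qed auto

lemma continuous_on_pl: "x_sorted ch \<Longrightarrow> continuous_on UNIV (pl ch)"
proof (induction ch rule: induct_list012)
  case (3 p q r)
  let ?l = "\<lambda>s. snd p + (s - fst p) * ((snd q - snd p) / (fst q - fst p))"
  have "pl (p # q # r) = (\<lambda>s. if s \<le> fst q then ?l s else pl (q # r) s)"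
    by auto
  moreover have "continuous_on UNIV (\<lambda>s. if s \<le> fst q then ?l s else pl (q # r) s)"
  proof (rule continuous_on_cases_le)
    show "continuous_on {t \<in> UNIV. fst q \<le> t} (pl (q # r))"
      using 3 by (auto intro: continuous_on_subset)
    show "?l t = pl (q # r) t" if "t = fst q" for t
      using 3 that pl_hd[of q r] by (auto simp del: pl.simps)
  qed (use 3 in \<open>auto intro!: continuous_intros\<close>)
  ultimately show ?case by simp
qed auto

text \<open>The hypotheses are weaker than \<open>hump_chain\<close> so that the induction can drop
  the first vertex: the rest starts at positive height and may have only two vertices, hence the
  disjunction.\<close>

lemma pl_pos:
  assumes "x_sorted ch" "length ch \<ge> 2" "0 \<le> snd (hd ch)" "0 \<le> snd (last ch)"
    "\<forall>p\<in>set (butlast (tl ch)). 0 < snd p" "length ch \<ge> 3 \<or> 0 < snd (hd ch)"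
    "fst (hd ch) < s" "s < fst (last ch)"
  shows "0 < pl ch s"
  using assms
proof (induction ch rule: induct_list012)
  case (3 p q r)
  have pq: "fst p < fst q" "fst p < s" using 3 by auto
  have q: "r \<noteq> [] \<Longrightarrow> 0 < snd q" using 3 by (cases r) auto
  consider "s < fst q" | "r \<noteq> []" "fst q = s" | "r \<noteq> []" "fst q < s"
    using 3(10) by (cases r) (auto, linarith)
  then show ?case
  proof cases
    case 1
    define l where "l = (s - fst p) / (fst q - fst p)"
    have l: "0 < l" "l < 1" using pq 1 by (auto simp: l_def)
    have "pl (p # q # r) s = (1 - l) * snd p + l * snd q"
      using 1 by (simp add: l_def algebra_simps diff_divide_distrib)
    moreover have "0 \<le> snd q" using q 3 by (cases r) auto
    moreover have "0 < snd p \<or> 0 < snd q" using q 3 by (cases r) auto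
    moreover have "0 \<le> snd p" using 3 by simp
    ultimately show ?thesis using l
      by (smt (verit) mult_nonneg_nonneg mult_pos_pos)
  next
    case 2
    then have "pl (p # q # r) s = snd q" using 3(3) pl_right[of p q r s] pl_hd[of q r] by auto
    then show ?thesis using q 2 by simp
  next
    case 3
    then have "pl (p # q # r) s = pl (q # r) s" by simp
    moreover have "0 < pl (q # r) s"
      using "3.IH"(2) "3.prems" 3 q by (cases r) (auto simp del: pl.simps)
    ultimately show ?thesis by simp
  qed
qed auto

definition chain_image :: "(real \<times> real) list \<Rightarrow> point set" where
  "chain_image ch = (\<Union>(p, q)\<in>set (zip ch (tl ch)). closed_segment (pt p) (pt q))"

lemma graph_of_affine_piece:
  assumes "fst p < fst q"
  shows "(\<lambda>s. vector [s, snd p + (s - fst p) * ((snd q - snd p) / (fst q - fst p))]) ` {fst p..fst q}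
    = closed_segment (pt p) (pt q)"
proof -
  have *: "snd p + u * (snd q - snd p) =
      snd p + ((1 - u) * fst p + u * fst q - fst p) * ((snd q - snd p) / (fst q - fst p))" for u
  proof -
    have "(1 - u) * fst p + u * fst q - fst p = u * (fst q - fst p)" by (simp add: algebra_simps)
    then show ?thesis using assms by simp
  qed
  have "{fst p..fst q} = (\<lambda>u. (1 - u) * fst p + u * fst q) ` {0..1}"
    using assms closed_segment_image_interval[of "fst p" "fst q"]
    by (simp add: closed_segment_eq_real_ivl)
  moreover have "vector [(1 - u) * fst p + u * fst q, snd p + ((1 - u) * fst p + u * fst q - fst p) *
      ((snd q - snd p) / (fst q - fst p))] = (1 - u) *\<^sub>R pt p + u *\<^sub>R pt q" for u
    unfolding * [symmetric] by (simp add: point_eq_iff algebra_simps)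
  ultimately show ?thesis
    unfolding closed_segment_image_interval[of "pt p"] by (simp add: image_image)
qed

lemma graph_of_pl:
  "x_sorted ch \<Longrightarrow> length ch \<ge> 2 \<Longrightarrow>
    (\<lambda>s. vector [s, pl ch s]) ` {fst (hd ch)..fst (last ch)} = chain_image ch"
proof (induction ch rule: induct_list012)
  case (3 p q r)
  let ?G = "\<lambda>ch s. vector [s, pl ch s] :: point"
  have pq: "fst p < fst q" using 3 by auto
  have ql: "fst q \<le> fst (last (q # r))"
    using 3(3) x_sorted_hd_le_last[of q r] by simp
  have "{fst p..fst (last (q # r))} = {fst p..fst q} \<union> {fst q..fst (last (q # r))}"
    using pq ql by auto
  then have "?G (p # q # r) ` {fst (hd (p # q # r))..fst (last (p # q # r))}
      = ?G (p # q # r) ` {fst p..fst q} \<union> ?G (p # q # r) ` {fst q..fst (last (q # r))}"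
    by (simp add: image_Un)
  also have "?G (p # q # r) ` {fst p..fst q} = closed_segment (pt p) (pt q)"
    unfolding graph_of_affine_piece[OF pq, symmetric] by (rule image_cong) auto
  also have "?G (p # q # r) ` {fst q..fst (last (q # r))} = ?G (q # r) ` {fst q..fst (last (q # r))}"
    by (rule image_cong) (use 3(3) in \<open>auto simp only: pl_right atLeastAtMost_iff\<close>)
  also have "closed_segment (pt p) (pt q) \<union> \<dots> = chain_image (p # q # r)"
  proof (cases r)
    case Nil
    then show ?thesis by (auto simp: chain_image_def)
  next
    case Cons
    then have "?G (q # r) ` {fst q..fst (last (q # r))} = chain_image (q # r)"
      using 3 by (simp del: pl.simps)
    then show ?thesis by (simp add: chain_image_def)
  qed
  finally show ?case .
qed auto

lemma hump_profile_pl: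
  assumes "hump_chain ch"
  shows "hump_profile (pl ch) (fst (hd ch)) (fst (last ch))"
proof
  obtain p q r where ch: "ch = p # q # r" "r \<noteq> []"
    using assms by (cases ch rule: remdups_adj.cases) (auto simp: hump_chain_def Suc_le_eq)
  have s: "x_sorted ch" and l: "snd (hd ch) = 0" "snd (last ch) = 0"
    and i: "\<forall>p\<in>set (butlast (tl ch)). 0 < snd p"
    using assms by (auto simp: hump_chain_def)
  have q: "0 < snd q" using i ch by simp
  show "fst (hd ch) < fst (last ch)" using s ch by auto
  show "continuous_on UNIV (pl ch)" by (rule continuous_on_pl[OF s])
  show "pl ch (fst (hd ch)) = 0" using pl_hd s l ch by auto
  show "pl ch (fst (last ch)) = 0" using pl_last[OF s] l ch by auto
  show "0 < pl ch t" if "fst (hd ch) < t" "t < fst (last ch)" for t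
    using pl_pos[OF s] l i that assms by (auto simp: hump_chain_def)
  show "pl ch t \<le> 0" if "t < fst (hd ch) \<or> fst (last ch) < t" for t
  proof (cases "t < fst (hd ch)")
    case True
    then have "t \<le> fst q" using s ch by auto
    then show ?thesis
      using True s ch l q by (auto intro!: divide_nonpos_pos mult_nonpos_nonneg)
  next
    case False
    then show ?thesis using that pl_last[OF s, of t] l ch by auto
  qed
qed

lemma frontier_hump_pl:
  assumes "hump_chain ch"
  shows "frontier (hump (pl ch)) = closed_segment (pt (hd ch)) (pt (last ch)) \<union> chain_image ch"
proof -
  interpret hump_profile "pl ch" "fst (hd ch)" "fst (last ch)" by (rule hump_profile_pl[OF assms])
  show ?thesis
    unfolding frontier_hump base_eq_segment using assms graph_of_pl[of ch]
    by (simp add: hump_chain_def)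
qed

lemma obstacle_hump:
  assumes "hump_chain ch"
  shows "obstacle (hump (pl ch))"
proof -
  interpret hump_profile "pl ch" "fst (hd ch)" "fst (last ch)" by (rule hump_profile_pl[OF assms])
  have "polygonal_set (frontier (hump (pl ch)))"
    unfolding polygonal_set_def frontier_hump_pl[OF assms] chain_image_def
    by (rule exI[of _ "insert (closed_segment (pt (hd ch)) (pt (last ch)))
         ((\<lambda>(p, q). closed_segment (pt p) (pt q)) ` set (zip ch (tl ch)))"]) (auto split: prod.splits)
  then show ?thesis
    unfolding obstacle_def
    using open_hump connected_hump hump_nonempty frontier_hump_simple_closed by blast
qed

section \<open>Same-side four-cycles have no inside obstacle\<close>

text \<open>An orientation test: \<open>det2 (v - u) (p - u)\<close> is positive exactly when
  \<open>p\<close> lies to the left of the line directed from \<open>u\<close> to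
  \<open>v\<close>.\<close>

definition det2 :: "point \<Rightarrow> point \<Rightarrow> real" where
  "det2 p q = p$1 * q$2 - p$2 * q$1"

text \<open>The ray is connected and unbounded, so the component of \<open>p\<close> in the
  complement of \<open>D\<close> is unbounded.\<close>

lemma ray_in_outside:
  fixes p d :: point
  assumes "d \<noteq> 0" and "\<And>s. 0 \<le> s \<Longrightarrow> p + s *\<^sub>R d \<notin> D"
  shows "p \<in> outside D"
proof -
  let ?R = "(\<lambda>s. p + s *\<^sub>R d) ` {0..}"
  have "connected ?R"
    by (intro connected_continuous_image continuous_intros) simp
  moreover have "p \<in> ?R" by (auto intro: image_eqI[of _ _ 0])
  moreover have "?R \<subseteq> - D" using assms(2) by auto
  ultimately have sub: "?R \<subseteq> connected_component_set (- D) p"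
    by (intro connected_component_maximal)
  have "\<not> bounded ?R"
  proof
    assume "bounded ?R"
    then obtain B where "\<forall>x\<in>?R. norm x \<le> B" by (auto simp: bounded_iff)
    then have B: "norm (p + s *\<^sub>R d) \<le> B" if "0 \<le> s" for s using that by auto
    let ?s = "(B + norm p + 1) / norm d"
    have "norm p \<le> B" using B[of 0] by simp
    then have "0 \<le> ?s" by (intro divide_nonneg_nonneg) (use norm_ge_zero[of p] norm_ge_zero[of d] in linarith)+
    have "0 \<le> B + norm p + 1" using \<open>norm p \<le> B\<close> norm_ge_zero[of p] by linarith
    then have "norm (?s *\<^sub>R d) = B + norm p + 1"
      using assms(1) by simp
    moreover have "norm (?s *\<^sub>R d) \<le> norm (p + ?s *\<^sub>R d) + norm p"
      using norm_triangle_ineq4[of "p + ?s *\<^sub>R d" p] by simp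
    ultimately show False using B[OF \<open>0 \<le> ?s\<close>] by linarith
  qed
  then show ?thesis using sub bounded_subset unfolding outside by blast
qed

lemma det2_eq_0_imp_multiple:
  assumes "det2 d w = 0" "d \<noteq> 0"
  obtains t where "w = t *\<^sub>R d"
proof (cases "d$1 = 0")
  case True
  then have "d$2 \<noteq> 0" using assms(2) by (simp add: point_eq_iff)
  then have "w = (w$2 / d$2) *\<^sub>R d" using assms(1) True by (simp add: point_eq_iff det2_def)
  then show ?thesis by (rule that)
next
  case False
  then have "w = (w$1 / d$1) *\<^sub>R d" using assms(1) by (simp add: point_eq_iff det2_def field_simps)
  then show ?thesis by (rule that)
qed

lemma collinear_iff_det2: "collinear {a, b, c :: point} \<longleftrightarrow> det2 (b - a) (c - a) = 0"
proof -
  have "collinear {a, b, c} \<longleftrightarrow> collinear {0, b - a, c - a}"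
    using collinear_3[of b a c] by (simp add: insert_commute)
  also have "\<dots> \<longleftrightarrow> det2 (b - a) (c - a) = 0"
  proof
    assume "collinear {0, b - a, c - a}"
    then consider "b - a = 0" | t where "c - a = t *\<^sub>R (b - a)"
      by (auto simp: collinear_lemma intro: that(2)[of 0])
    then show "det2 (b - a) (c - a) = 0"
      by cases (auto simp: det2_def simp del: vector_minus_component)
  next
    assume "det2 (b - a) (c - a) = 0"
    then show "collinear {0, b - a, c - a}"
      using det2_eq_0_imp_multiple[of "b - a" "c - a"] unfolding collinear_lemma by metis
  qed
  finally show ?thesis .
qed

lemma four_cycle_no_inside_obstacle:
  fixes u v x y :: point
  assumes "connected C" "C \<inter> D = {}" "C \<inter> outside D = {}"
    and edges: "closed_segment u x \<subseteq> D" "closed_segment u y \<subseteq> D"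
      "closed_segment v x \<subseteq> D" "closed_segment v y \<subseteq> D"
    and uv: "C \<inter> closed_segment u v \<noteq> {}" and xy: "C \<inter> closed_segment x y \<noteq> {}"
    and hx: "0 < det2 (v - u) (x - u)" and hy: "0 < det2 (v - u) (y - u)"
    and line: "\<And>p. p \<in> D \<Longrightarrow> det2 (v - u) (p - u) = 0 \<Longrightarrow> p \<in> closed_segment u v"
  shows False
proof -
  define h where "h = (\<lambda>p. det2 (v - u) (p - u))"
  \<comment> \<open>For \<open>0 < h w\<close>, the points of the upper half-plane with
    \<open>T w p\<close> form the open triangle \<open>u v w\<close>. Leaving \<open>h\<close> out
    of \<open>T\<close> keeps the condition open across the segment from \<open>u\<close> to
    \<open>v\<close>.\<close>
  define T T' where "T = (\<lambda>w p. det2 (w - u) (p - u) < 0 \<and> 0 < det2 (w - v) (p - v))"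
    and "T' = (\<lambda>w p. det2 (w - u) (p - u) \<le> 0 \<and> 0 \<le> det2 (w - v) (p - v))"
  \<comment> \<open>Two disjoint open sets. \<open>Q\<close> joins the lower half-plane to the
    common part of both triangles through the open segment from \<open>u\<close> to
    \<open>v\<close>; \<open>R\<close> is the upper half-plane without the common part of the
    triangles, now closed along their sides at \<open>x\<close> and \<open>y\<close> so that
    \<open>R\<close> is open.\<close>
  define Q R where "Q = {p. h p < 0 \<or> T x p \<and> T y p}" and "R = {p. 0 < h p \<and> \<not> (T' x p \<and> T' y p)}"
  have uv_ne: "v - u \<noteq> 0" using hx by (auto simp: det2_def)
  have uvD: "u \<in> D" "v \<in> D" using edges by auto
  \<comment> \<open>Beyond \<open>u\<close> or \<open>v\<close> the line is free of
    \<open>D\<close>, so a point there could escape along it and would lie outside; this forces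
    \<open>0 < t < 1\<close>.\<close>
  have on_line: "T w p" if "p \<in> C" "h p = 0" "0 < h w" for p w
  proof -
    obtain t where t: "p - u = t *\<^sub>R (v - u)"
      using \<open>h p = 0\<close> uv_ne det2_eq_0_imp_multiple unfolding h_def by blast
    then have p: "p = u + t *\<^sub>R (v - u)" by (simp add: algebra_simps)
    have "p \<notin> outside D" "p \<notin> D" using assms that(1) by auto
    have seg: "closed_segment u v = {u + s *\<^sub>R (v - u) |s. 0 \<le> s \<and> s \<le> 1}"
      by (auto simp: closed_segment_def algebra_simps)
    have inj: "s = s'" if "u + s *\<^sub>R (v - u) = u + s' *\<^sub>R (v - u)" for s s' :: real
      using that(1) uv_ne by simp
    have hz: "det2 (v - u) (u + s *\<^sub>R (v - u) - u) = 0" for s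
      by (simp add: det2_def algebra_simps)
    have "t \<le> 1"
    proof (rule ccontr)
      assume "\<not> t \<le> 1"
      have "p \<in> outside D"
      proof (rule ray_in_outside[OF uv_ne])
        fix s :: real assume "0 \<le> s"
        have e: "p + s *\<^sub>R (v - u) = u + (t + s) *\<^sub>R (v - u)" by (simp add: p algebra_simps)
        show "p + s *\<^sub>R (v - u) \<notin> D"
          using line[of "u + (t + s) *\<^sub>R (v - u)"] hz[of "t + s"] inj \<open>0 \<le> s\<close> \<open>\<not> t \<le> 1\<close>
          unfolding e seg by fastforce
      qed
      then show False using \<open>p \<notin> outside D\<close> by simp
    qed
    moreover have "0 \<le> t"
    proof (rule ccontr)
      assume "\<not> 0 \<le> t"
      have "p \<in> outside D"
      proof (rule ray_in_outside)
        show "u - v \<noteq> 0" using uv_ne by auto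
        fix s :: real assume "0 \<le> s"
        have e: "p + s *\<^sub>R (u - v) = u + (t - s) *\<^sub>R (v - u)" by (simp add: p algebra_simps)
        show "p + s *\<^sub>R (u - v) \<notin> D"
          using line[of "u + (t - s) *\<^sub>R (v - u)"] hz[of "t - s"] inj \<open>0 \<le> s\<close> \<open>\<not> 0 \<le> t\<close>
          unfolding e seg by fastforce
      qed
      then show False using \<open>p \<notin> outside D\<close> by simp
    qed
    moreover have "t \<noteq> 0" "t \<noteq> 1" using p \<open>p \<notin> D\<close> uvD by auto
    ultimately have "0 < t * h w" "0 < (1 - t) * h w" using that(3) by auto
    moreover have "det2 (w - u) (p - u) = - (t * h w)" "det2 (w - v) (p - v) = (1 - t) * h w"
      by (simp_all add: p h_def det2_def algebra_simps)
    ultimately show ?thesis by (simp add: T_def)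
  qed
  \<comment> \<open>A point of the upper half-plane on the border of \<open>T' w\<close> lies on one
    of the two edges at \<open>w\<close>, which belong to \<open>D\<close>.\<close>
  have strict: "T w p" if "T' w p" "0 < h p" "0 < h w" "p \<notin> D"
    "closed_segment u w \<subseteq> D" "closed_segment v w \<subseteq> D" for w p
  proof -
    have "det2 (w - u) (p - u) \<noteq> 0"
    proof
      assume "det2 (w - u) (p - u) = 0"
      moreover have "w - u \<noteq> 0" using that(3) by (auto simp: h_def det2_def)
      ultimately obtain t where t: "p - u = t *\<^sub>R (w - u)" by (rule det2_eq_0_imp_multiple)
      then have p: "p = (1 - t) *\<^sub>R u + t *\<^sub>R w" by (simp add: algebra_simps)
      have "h p = t * h w" "det2 (w - v) (p - v) = (1 - t) * h w"
        by (simp_all add: p h_def det2_def algebra_simps)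
      then have "0 \<le> t" "t \<le> 1"
        using that(1,2,3) by (auto simp: T'_def zero_less_mult_iff zero_le_mult_iff)
      then have "p \<in> closed_segment u w" unfolding closed_segment_def p by blast
      then show False using that by blast
    qed
    moreover have "det2 (w - v) (p - v) \<noteq> 0"
    proof
      assume "det2 (w - v) (p - v) = 0"
      moreover have "w - v \<noteq> 0" using that(3) by (auto simp: h_def det2_def)
      ultimately obtain t where t: "p - v = t *\<^sub>R (w - v)" by (rule det2_eq_0_imp_multiple)
      then have p: "p = (1 - t) *\<^sub>R v + t *\<^sub>R w" by (simp add: algebra_simps)
      have "h p = t * h w" "det2 (w - u) (p - u) = - ((1 - t) * h w)"
        by (simp_all add: p h_def det2_def algebra_simps)
      then have "0 \<le> t" "t \<le> 1"
        using that(1,2,3) by (auto simp: T'_def zero_less_mult_iff zero_le_mult_iff)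
      then have "p \<in> closed_segment v w" unfolding closed_segment_def p by blast
      then show False using that by blast
    qed
    ultimately show ?thesis using that(1) by (auto simp: T_def T'_def)
  qed
  have h_pos: "0 < h x" "0 < h y" using hx hy by (auto simp: h_def)
  have "C \<subseteq> Q \<union> R"
  proof
    fix p assume p: "p \<in> C"
    then have "p \<notin> D" using assms by auto
    then show "p \<in> Q \<union> R"
      using on_line[OF p, of x] on_line[OF p, of y] strict[of x p] strict[of y p] h_pos edges
      unfolding Q_def R_def by (cases "h p = 0") auto
  qed
  moreover have "open Q" "open R"
    unfolding Q_def R_def T_def T'_def h_def det2_def de_Morgan_conj not_le
    by (intro open_Collect_conj open_Collect_disj open_Collect_less continuous_intros)+
  moreover have "Q \<inter> R = {}"
    by (auto simp: Q_def R_def T_def T'_def)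
  ultimately have "Q \<inter> C = {} \<or> R \<inter> C = {}"
    using connectedD[OF assms(1), of Q R] by blast
  moreover have "Q \<inter> C \<noteq> {}"
  proof -
    obtain p where p: "p \<in> C" "p \<in> closed_segment u v" using uv by auto
    then obtain t where t: "p = (1 - t) *\<^sub>R u + t *\<^sub>R v" by (auto simp: closed_segment_def)
    have "h p = 0" unfolding t h_def det2_def by (simp add: algebra_simps)
    then show ?thesis using on_line[OF p(1)] h_pos p(1) by (auto simp: Q_def)
  qed
  ultimately have "C \<subseteq> Q" using \<open>C \<subseteq> Q \<union> R\<close> by blast
  moreover obtain p where p: "p \<in> C" "p \<in> closed_segment x y" using xy by auto
  ultimately have "p \<in> Q" by auto
  obtain t where t: "p = (1 - t) *\<^sub>R x + t *\<^sub>R y" "0 \<le> t" "t \<le> 1"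
    using p by (auto simp: closed_segment_def)
  have "h p = (1 - t) * h x + t * h y" unfolding t(1) h_def det2_def by (simp add: algebra_simps)
  moreover have "0 < (1 - t) * h x + t * h y"
    using t h_pos by (cases "t = 0") (auto intro!: add_nonneg_pos)
  ultimately have "T x p" "T y p" using \<open>p \<in> Q\<close> by (auto simp: Q_def)
  \<comment> \<open>Seen from \<open>u\<close>, the point \<open>p\<close> lies within the angle
    between \<open>x\<close> and \<open>y\<close>, yet the two conditions put it strictly clockwise
    of both.\<close>
  then have "t * det2 (x - u) (y - u) < 0" "(1 - t) * - det2 (x - u) (y - u) < 0"
    unfolding T_def t(1) det2_def by (simp_all add: algebra_simps)
  then show False
    using t by (auto simp: mult_less_0_iff zero_less_mult_iff)
qed

lemma four_cycle_same_side_no_inside_obstacle: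
  fixes u v x y :: point
  assumes "connected C" "C \<inter> D = {}" "C \<inter> outside D = {}"
    and "closed_segment u x \<subseteq> D" "closed_segment u y \<subseteq> D"
      "closed_segment v x \<subseteq> D" "closed_segment v y \<subseteq> D"
    and "C \<inter> closed_segment u v \<noteq> {}" and "C \<inter> closed_segment x y \<noteq> {}"
    and side: "0 < det2 (v - u) (x - u) * det2 (v - u) (y - u)"
    and line: "\<And>p. p \<in> D \<Longrightarrow> det2 (v - u) (p - u) = 0 \<Longrightarrow> p \<in> closed_segment u v"
  shows False
proof (cases "0 < det2 (v - u) (x - u)")
  case True
  then have "0 < det2 (v - u) (y - u)" using side by (simp add: zero_less_mult_iff)
  then show False using four_cycle_no_inside_obstacle[of C D u x y v] assms True by blast
next
  case False
  \<comment> \<open>Exchanging \<open>u\<close> and \<open>v\<close> reverses the line, which turns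
    two negative sides into positive ones.\<close>
  have swap: "det2 (u - v) (p - v) = - det2 (v - u) (p - u)" for p
    by (simp add: det2_def algebra_simps)
  have "0 < det2 (u - v) (x - v)" "0 < det2 (u - v) (y - v)"
    using False side by (auto simp: swap zero_less_mult_iff)
  moreover have "p \<in> closed_segment v u" if "p \<in> D" "det2 (u - v) (p - v) = 0" for p
    using line[of p] that by (simp add: swap closed_segment_commute)
  ultimately show False
    using four_cycle_no_inside_obstacle[of C D v x y u] assms
    by (simp add: closed_segment_commute[of v u])
qed

lemma K23_no_inside_obstacle_rep: "\<not> inside_obstacle_rep K23_V K23_E P C"
proof
  assume "inside_obstacle_rep K23_V K23_E P C"
  then have C: "obstacle C" "general_position P" "P \<inter> C = {}" "C \<inter> outside (vis_drawing P C) = {}"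
    and "graph_iso K23_V K23_E P (visible C)"
    by (auto simp: inside_obstacle_rep_def single_obstacle_rep_def)
  then obtain f where f: "bij_betw f K23_V P"
    and adj: "\<And>i j. i \<in> K23_V \<Longrightarrow> j \<in> K23_V \<Longrightarrow> visible C (f i) (f j) \<longleftrightarrow> K23_E i j"
    by (auto simp: graph_iso_def)
  let ?D = "vis_drawing P C" and ?h = "\<lambda>p. det2 (f 1 - f 0) (p - f 0)"
  have V: "K23_V = {0, 1, 2, 3, 4}" by (auto simp: K23_V_def)
  have P: "P = f ` K23_V" and inj: "inj_on f K23_V" using f by (auto simp: bij_betw_def)
  have ne: "f i \<noteq> f j" if "i \<in> K23_V" "j \<in> K23_V" "i \<noteq> j" for i j
    using inj that by (auto dest: inj_onD)
  have seg: "closed_segment (f i) (f j) \<subseteq> ?D" if "i \<in> {0, 1}" "j \<in> {2, 3, 4}" for i j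
  proof -
    have "i \<in> K23_V" "j \<in> K23_V" "K23_E i j" using that by (auto simp: V K23_E_def)
    then have "visible C (f i) (f j)" "f i \<in> P" "f j \<in> P" using adj by (auto simp: P)
    then show ?thesis by (auto simp: vis_drawing_def)
  qed
  have blocked: "C \<inter> closed_segment (f i) (f j) \<noteq> {}"
    if "i \<in> K23_V" "j \<in> K23_V" "i \<noteq> j" "\<not> K23_E i j" for i j
    using adj[OF that(1,2)] ne[OF that(1,2,3)] that(4) by (auto simp: visible_def)
  have h: "?h (f j) \<noteq> 0" if "j \<in> {2, 3, 4}" for j
  proof -
    have j: "j \<in> K23_V" "0 \<noteq> j" "1 \<noteq> j" using that by (auto simp: V)
    have "\<not> collinear {f 0, f 1, f j}"
      using C(2)[unfolded general_position_def, rule_format, of "f 0" "f 1" "f j"]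
        j ne[of 0 1] ne[of 0 j] ne[of 1 j] by (auto simp: V P)
    then show ?thesis by (simp add: collinear_iff_det2)
  qed
  have CD: "C \<inter> ?D = {}"
    using C(3) by (auto simp: vis_drawing_def visible_def)
  have line: "p \<in> closed_segment (f 0) (f 1)" if "p \<in> ?D" "?h p = 0" for p
  proof -
    have end_case: "p \<in> closed_segment (f 0) (f 1)"
      if "p \<in> closed_segment (f i) (f j)" "i \<in> {0, 1}" "j \<in> {2, 3, 4}" for i j
    proof -
      obtain t where t: "p = (1 - t) *\<^sub>R f i + t *\<^sub>R f j"
        using \<open>p \<in> closed_segment (f i) (f j)\<close> by (auto simp: closed_segment_def)
      \<comment> \<open>\<open>?h\<close> is affine and vanishes at \<open>f 0\<close> and
        \<open>f 1\<close>, so along an edge it is proportional to the distance from the end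
        \<open>f i\<close>.\<close>
      have "?h p = t * ?h (f j)" using that(2) unfolding t det2_def
        by (auto simp: algebra_simps)
      then have "t = 0" using \<open>?h p = 0\<close> h[OF that(3)] by simp
      then show ?thesis using that(2) t by auto
    qed
    consider i where "i \<in> K23_V" "p = f i"
      | i j where "p \<in> closed_segment (f i) (f j)" "i \<in> K23_V" "j \<in> K23_V" "K23_E i j"
      using \<open>p \<in> ?D\<close> adj by (auto simp: vis_drawing_def P)
    then show ?thesis
    proof cases
      case 1
      then show ?thesis using h[of i] \<open>?h p = 0\<close> by (auto simp: V)
    next
      case 2
      then show ?thesis
        using end_case[of i j] end_case[of j i] by (auto simp: K23_E_def closed_segment_commute)
    qed
  qed
  have neg: "\<not> 0 < ?h (f i) * ?h (f j)" if "i \<in> {2, 3, 4}" "j \<in> {2, 3, 4}" "i \<noteq> j" for i j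
  proof
    assume "0 < ?h (f i) * ?h (f j)"
    moreover have "C \<inter> closed_segment (f i) (f j) \<noteq> {}"
      using that by (intro blocked) (auto simp: V K23_E_def)
    moreover have "C \<inter> closed_segment (f 0) (f 1) \<noteq> {}"
      by (intro blocked) (auto simp: V K23_E_def)
    ultimately show False
      using four_cycle_same_side_no_inside_obstacle[of C ?D "f 0" "f i" "f j" "f 1"]
        C CD seg that line by (simp add: obstacle_def)
  qed
  \<comment> \<open>Among three nonzero reals two have the same sign.\<close>
  show False
    using neg[of 2 3] neg[of 2 4] neg[of 3 4] h[of 2] h[of 3] h[of 4]
    by (simp add: zero_less_mult_iff) linarith
qed

section \<open>Inside representations from coordinates\<close>

fun pairs :: "'a list \<Rightarrow> ('a \<times> 'a) list" where
  "pairs [] = []"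
| "pairs (x # xs) = map (Pair x) xs @ pairs xs"

text \<open>The upper triangle of the adjacency matrix, row by row. For five vertices the entries 0,
  1 and 4 are the pairs among the first three.\<close>

abbreviation adj_code :: "('a \<Rightarrow> 'a \<Rightarrow> bool) \<Rightarrow> 'a list \<Rightarrow> bool list" where
  "adj_code R xs \<equiv> map (case_prod R) (pairs xs)"

lemma visible_sym: "visible C p q \<longleftrightarrow> visible C q p"
  by (auto simp: visible_def closed_segment_commute)

lemma segment_subset_vis_drawing:
  "p \<in> P \<Longrightarrow> q \<in> P \<Longrightarrow> visible C p q \<Longrightarrow> closed_segment p q \<subseteq> vis_drawing P C"
  by (auto simp: vis_drawing_def)

lemma pairs_map: "pairs (map f xs) = map (map_prod f f) (pairs xs)"
  by (induction xs) auto

lemma set_pairs: "set (pairs xs) \<subseteq> set xs \<times> set xs"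
  by (induction xs) auto

lemma adj_code_eq_nth:
  assumes "length xs = length ys" "adj_code R xs = adj_code S ys" "i < j" "j < length xs"
  shows "R (xs ! i) (xs ! j) \<longleftrightarrow> S (ys ! i) (ys ! j)"
  using assms
proof (induction xs ys arbitrary: i j rule: list_induct2)
  case (Cons x xs y ys)
  from Cons have "map (R x) xs = map (S y) ys" "adj_code R xs = adj_code S ys"
    by (auto simp: append_eq_append_conv comp_def)
  moreover from this(1) have "R x (xs ! k) \<longleftrightarrow> S y (ys ! k)" if "k < length xs" for k
    using that Cons.hyps by (metis length_map nth_map)
  ultimately show ?case
    using Cons by (cases j; cases i) auto
qed auto

text \<open>Entries at equal positions correspond; symmetry and irreflexivity supply the part of the
  matrix that the code omits.\<close>

lemma graph_iso_adj_code:
  assumes "distinct xs" "distinct ys" "length xs = length ys" "adj_code R xs = adj_code S ys"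
    and sym: "\<And>u v. R u v \<Longrightarrow> R v u" "\<And>u v. S u v \<Longrightarrow> S v u"
    and irrefl: "\<And>u. \<not> R u u" "\<And>u. \<not> S u u"
  shows "graph_iso (set xs) R (set ys) S"
proof -
  let ?n = "length xs"
  have RS: "R (xs ! i) (xs ! j) \<longleftrightarrow> S (ys ! i) (ys ! j)" if "i < ?n" "j < ?n" for i j
    using adj_code_eq_nth[OF assms(3,4), of i j] adj_code_eq_nth[OF assms(3,4), of j i] that sym irrefl
    by (metis linorder_neqE_nat)
  have bx: "bij_betw ((!) xs) {..<?n} (set xs)" and bys: "bij_betw ((!) ys) {..<?n} (set ys)"
    using assms(1-3) by (auto intro!: bij_betw_nth)
  define g where "g = inv_into {..<?n} ((!) xs)"
  have g: "g (xs ! i) = i" if "i < ?n" for i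
    using bx that by (simp add: g_def bij_betw_inv_into_left)
  have "bij_betw ((!) ys \<circ> g) (set xs) (set ys)"
    unfolding g_def using bij_betw_inv_into[OF bx] bys by (rule bij_betw_trans)
  then show ?thesis
    unfolding graph_iso_def
    by (intro exI[of _ "(!) ys \<circ> g"]) (auto simp: in_set_conv_nth g RS)
qed

text \<open>A predicate on bits instead of graphs, so that each example becomes a rewrite rule for a
  literal list.\<close>

definition inside_code :: "bool list \<Rightarrow> bool" where
  "inside_code bs \<longleftrightarrow> (\<exists>qs C. length qs = 5 \<and> distinct qs \<and> obstacle C \<and> set qs \<inter> C = {} \<and>
     general_position (set qs) \<and> C \<inter> outside (vis_drawing (set qs) C) = {} \<and> adj_code (visible C) qs = bs)"

lemma inside_rep_of_adj_code:
  assumes "graph V E" "set vs = V" "distinct vs" "length vs = 5" "inside_code (adj_code E vs)"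
  shows "\<exists>P C. inside_obstacle_rep V E P C"
proof -
  obtain qs C where "length qs = 5" "distinct qs" "obstacle C" "set qs \<inter> C = {}"
    "general_position (set qs)" "C \<inter> outside (vis_drawing (set qs) C) = {}" "adj_code (visible C) qs = adj_code E vs"
    using assms(5) by (auto simp: inside_code_def)
  moreover from this have "graph_iso (set vs) E (set qs) (visible C)"
    using assms by (intro graph_iso_adj_code) (auto simp: visible_def closed_segment_commute graph_def)
  ultimately show ?thesis
    using assms(2) by (auto simp: inside_obstacle_rep_def single_obstacle_rep_def)
qed

text \<open>\<open>sorted_wrt\<close> only serves to range over the pairs in list order, so each
  triple is tested once. The inequality says that a \<open>det2\<close> is nonzero.\<close>

fun gp_list :: "(real \<times> real) list \<Rightarrow> bool" where
  "gp_list [] = True"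
| "gp_list (p # ps) \<longleftrightarrow> gp_list ps \<and> sorted_wrt (\<lambda>q r.
     (fst q - fst p) * (snd r - snd p) \<noteq> (snd q - snd p) * (fst r - fst p)) ps"

lemma general_position_gp_list: "gp_list ps \<Longrightarrow> general_position (pt ` set ps)"
proof (induction ps)
  case (Cons p ps)
  have c: "\<not> collinear {pt p, pt q, pt r}" if "q \<in> set ps" "r \<in> set ps" "q \<noteq> r" for q r
  proof -
    have "(fst q - fst p) * (snd r - snd p) \<noteq> (snd q - snd p) * (fst r - fst p)"
      using that Cons.prems by (induction ps) (auto simp: mult.commute)
    then show ?thesis by (simp add: collinear_iff_det2 det2_def)
  qed
  have c': "\<not> collinear {pt p, x, y}" if "x \<in> pt ` set ps" "y \<in> pt ` set ps" "x \<noteq> y" for x y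
    using c that by auto
  have IH: "general_position (pt ` set ps)" using Cons by simp
  show ?case
    unfolding general_position_def
  proof (intro ballI impI)
    fix x y z assume xyz: "x \<in> pt ` set (p # ps)" "y \<in> pt ` set (p # ps)" "z \<in> pt ` set (p # ps)"
      and ne: "x \<noteq> y \<and> x \<noteq> z \<and> y \<noteq> z"
    have mem: "w \<in> pt ` set ps" if "w \<in> {x, y, z}" "w \<noteq> pt p" for w
      using xyz that by auto
    consider "x = pt p" | "y = pt p" | "z = pt p" | "x \<noteq> pt p" "y \<noteq> pt p" "z \<noteq> pt p" by blast
    then show "\<not> collinear {x, y, z}"
    proof cases
      case 1
      then show ?thesis using c'[of y z] mem[of y] mem[of z] ne by blast
    next
      case 2
      then have eq: "{x, y, z} = {pt p, x, z}" by auto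
      show ?thesis unfolding eq using c'[of x z] mem[of x] mem[of z] ne 2 by blast
    next
      case 3
      then have eq: "{x, y, z} = {pt p, x, y}" by auto
      show ?thesis unfolding eq using c'[of x y] mem[of x] mem[of y] ne 3 by blast
    next
      case 4
      then show ?thesis
        using IH[unfolded general_position_def, rule_format, of x y z] mem[of x] mem[of y] mem[of z] ne
        by blast
    qed
  qed
qed (auto simp: general_position_def)

text \<open>For concrete coordinates, unfolding \<open>pl\<close> leaves linear inequalities in
  \<open>t\<close>. The premise on the height exempts the part of the segment on or below the base
  line, where the hump has no points.\<close>

definition clear :: "(real \<times> real) list \<Rightarrow> real \<times> real \<Rightarrow> real \<times> real \<Rightarrow> bool" where
  "clear ch p q \<longleftrightarrow> (\<forall>t. 0 \<le> t \<longrightarrow> t \<le> 1 \<longrightarrow> 0 < snd p + t * (snd q - snd p) \<longrightarrow>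
     pl ch (fst p + t * (fst q - fst p)) \<le> snd p + t * (snd q - snd p))"

text \<open>Only sufficient for being blocked, whereas \<open>clear\<close> is equivalent to
  visibility for distinct points.\<close>

definition midpoint_hit :: "(real \<times> real) list \<Rightarrow> real \<times> real \<Rightarrow> real \<times> real \<Rightarrow> bool" where
  "midpoint_hit ch p q \<longleftrightarrow> 0 < (snd p + snd q) / 2 \<and> (snd p + snd q) / 2 < pl ch ((fst p + fst q) / 2)"

lemma visible_hump_clear:
  assumes "clear ch p q" "p \<noteq> q"
  shows "visible (hump (pl ch)) (pt p) (pt q)"
proof -
  have "x \<notin> hump (pl ch)" if "x \<in> closed_segment (pt p) (pt q)" for x
  proof -
    obtain t where t: "0 \<le> t" "t \<le> 1" "x = (1 - t) *\<^sub>R pt p + t *\<^sub>R pt q"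
      using \<open>x \<in> closed_segment (pt p) (pt q)\<close> unfolding closed_segment_def by blast
    have "x$1 = fst p + t * (fst q - fst p)" "x$2 = snd p + t * (snd q - snd p)"
      unfolding t(3) by (simp_all add: algebra_simps)
    then show ?thesis
      using assms(1) t(1,2) by (auto simp: clear_def hump_def not_less)
  qed
  then show ?thesis
    using assms(2) by (auto simp: visible_def point_eq_iff prod_eq_iff)
qed

lemma not_visible_midpoint_hit:
  assumes "midpoint_hit ch p q"
  shows "\<not> visible (hump (pl ch)) (pt p) (pt q)"
proof -
  have "midpoint (pt p) (pt q) \<in> hump (pl ch)"
    using assms by (simp add: midpoint_hit_def hump_def midpoint_def)
  moreover have "midpoint (pt p) (pt q) \<in> closed_segment (pt p) (pt q)" by simp
  ultimately show ?thesis unfolding visible_def by blast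
qed

lemma adj_code_visible_hump:
  assumes "distinct ps"
    and "list_all2 (\<lambda>b (p, q). if b then clear ch p q else midpoint_hit ch p q) bs (pairs ps)"
  shows "adj_code (visible (hump (pl ch))) (map pt ps) = bs"
proof -
  have ne: "p \<noteq> q" if "(p, q) \<in> set (pairs ps)" for p q
    using that assms(1) by (induction ps) auto
  show ?thesis
  proof (rule nth_equalityI)
    show "length (adj_code (visible (hump (pl ch))) (map pt ps)) = length bs"
      using assms(2) by (simp add: pairs_map list_all2_lengthD)
    fix i assume "i < length (adj_code (visible (hump (pl ch))) (map pt ps))"
    then have i: "i < length (pairs ps)" by (simp add: pairs_map)
    obtain p q where pq: "pairs ps ! i = (p, q)" by (cases "pairs ps ! i")
    then have "if bs ! i then clear ch p q else midpoint_hit ch p q"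
      using assms(2) i by (auto simp: list_all2_conv_all_nth)
    then have "visible (hump (pl ch)) (pt p) (pt q) \<longleftrightarrow> bs ! i"
      using visible_hump_clear not_visible_midpoint_hit ne[of p q] nth_mem[OF i] pq by (metis (full_types))
    then show "adj_code (visible (hump (pl ch))) (map pt ps) ! i \<longleftrightarrow> bs ! i"
      using i pq by (simp add: pairs_map)
  qed
qed

text \<open>\<open>edges\<close> also covers the base, the pair \<open>(hd cyc, last cyc)\<close>;
  it has two disjuncts because \<open>pairs\<close> lists every pair in one order only.
  \<open>sub\<close> compares the profiles only where \<open>pl ch\<close> is positive, since
  elsewhere the obstacle has no points.\<close>

lemma inside_codeI:
  assumes len: "length ps = 5" "distinct ps" and gp: "gp_list ps"
    and ch: "hump_chain ch" and cyc: "hump_chain cyc"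
    and free: "\<forall>p\<in>set ps. 0 < snd p \<longrightarrow> pl ch (fst p) \<le> snd p"
    and code: "list_all2 (\<lambda>b (p, q). if b then clear ch p q else midpoint_hit ch p q) bs (pairs ps)"
    and sub: "\<forall>s. 0 < pl ch s \<longrightarrow> pl ch s \<le> pl cyc s"
    and edges: "\<forall>(p, q)\<in>set ((hd cyc, last cyc) # zip cyc (tl cyc)).
      (True, p, q) \<in> set (zip bs (pairs ps)) \<or> (True, q, p) \<in> set (zip bs (pairs ps))"
  shows "inside_code bs"
proof -
  let ?C = "hump (pl ch)" and ?P = "set (map pt ps)"
  have inj: "inj pt" by (auto simp: inj_on_def point_eq_iff prod_eq_iff)
  interpret M: hump_profile "pl cyc" "fst (hd cyc)" "fst (last cyc)" by (rule hump_profile_pl[OF cyc])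
  have vis: "visible ?C (pt p) (pt q)" if "(True, p, q) \<in> set (zip bs (pairs ps))" for p q
  proof -
    obtain i where i: "i < length (pairs ps)" "i < length bs" "bs ! i" "pairs ps ! i = (p, q)"
      using \<open>(True, p, q) \<in> set (zip bs (pairs ps))\<close> by (auto simp: in_set_zip)
    have "visible ?C (pt p) (pt q) \<longleftrightarrow> adj_code (visible ?C) (map pt ps) ! i"
      using i by (simp add: pairs_map)
    then show ?thesis
      using i adj_code_visible_hump[OF len(2) code] by simp
  qed
  have seg: "closed_segment (pt p) (pt q) \<subseteq> vis_drawing ?P ?C"
    if "(p, q) \<in> set ((hd cyc, last cyc) # zip cyc (tl cyc))" for p q
  proof -
    have "(True, p, q) \<in> set (zip bs (pairs ps)) \<or> (True, q, p) \<in> set (zip bs (pairs ps))"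
      using edges that by fast
    then have "visible ?C (pt p) (pt q)" "(p, q) \<in> set (pairs ps) \<or> (q, p) \<in> set (pairs ps)"
      using vis[of p q] vis[of q p] visible_sym[of ?C "pt p"] set_zip_rightD by fast+
    moreover from this(2) have "p \<in> set ps" "q \<in> set ps"
      using set_pairs[of ps] by auto
    ultimately show ?thesis by (intro segment_subset_vis_drawing) simp_all
  qed
  have "frontier (hump (pl cyc)) \<subseteq> vis_drawing ?P ?C"
    unfolding frontier_hump_pl[OF cyc] chain_image_def
    by (intro Un_least UN_least) (auto simp del: set_map intro!: seg[THEN subsetD])
  then have "outside (vis_drawing ?P ?C) \<subseteq> - closure (hump (pl cyc))"
    using outside_mono outside_frontier_misses_closure[OF M.bounded_hump] by blast
  moreover have "?C \<subseteq> hump (pl cyc)"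
  proof
    fix x assume "x \<in> ?C"
    then have "0 < x$2" "x$2 < pl ch (x$1)" by (auto simp: hump_def)
    then show "x \<in> hump (pl cyc)"
      using sub[rule_format, of "x$1"] by (simp add: hump_def)
  qed
  ultimately have "?C \<inter> outside (vis_drawing ?P ?C) = {}"
    using closure_subset by blast
  moreover have "?P \<inter> ?C = {}"
    using free by (auto simp: hump_def)
  ultimately show ?thesis
    unfolding inside_code_def
    using len inj obstacle_hump[OF ch] general_position_gp_list[OF gp] adj_code_visible_hump[OF len(2) code]
    by (intro exI[of _ "map pt ps"] exI[of _ ?C]) (auto simp: distinct_map intro: inj_on_subset)
qed

section \<open>Coordinates of inside representations\<close>

text \<open>The coordinates below were found by computer search. In each example the first three points
  form a triangle, except in the last three, which represent a five-cycle, a four-cycle with a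
  pendant vertex and a four-cycle with an isolated vertex.\<close>

named_theorems inside_codes

text \<open>Distributing division over sums brings the inequalities of \<open>clear\<close> closer
  to linear terms in its parameter.\<close>

lemmas numeric_simps =
  hump_chain_def clear_def midpoint_hit_def add_divide_distrib diff_divide_distrib

text \<open>The isolated points (4,3) and (8,2) sit at the bottom of notches of \<open>ch\<close>.
  The obstacle is open and does not contain them, but the walls of the notches block every segment
  from them.\<close>

lemma [inside_codes]: "inside_code [True, True, False, False, True, False, False, False, False, False]"
  by (rule inside_codeI[where ps = "[(0,0), (12,0), (6,12), (4,3), (8,2)]"
        and ch = "[(0,0), (3,6), (4,3), (5,10), (7,10), (8,2), (9,6), (12,0)]"
        and cyc = "[(0,0), (6,12), (12,0)]"];
      (simp add: numeric_simps)?; auto)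

lemma [inside_codes]: "inside_code [True, True, False, False, True, False, False, False, False, True]"
  by (rule inside_codeI[where ps = "[(0,0), (12,0), (6,12), (9,1), (9,2)]"
        and ch = "[(0,0), (3,1), (7,10), (9,1), (10,3), (12,0)]"
        and cyc = "[(0,0), (6,12), (12,0)]"];
      (simp add: numeric_simps)?; auto)

lemma [inside_codes]: "inside_code [True, True, False, False, True, False, False, True, False, False]"
  by (rule inside_codeI[where ps = "[(0,0), (12,0), (6,12), (6,9), (8,3)]"
        and ch = "[(0,0), (3,5), (7,9), (8,1), (9,6), (12,0)]"
        and cyc = "[(0,0), (6,12), (12,0)]"];
      (simp add: numeric_simps)?; auto)

lemma [inside_codes]: "inside_code [True, True, False, True, True, False, False, False, False, True]"
  by (rule inside_codeI[where ps = "[(0,0), (12,0), (6,12), (4,2), (4,7)]"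
        and ch = "[(1,0), (3,4), (4,2), (5,10), (12,0)]"
        and cyc = "[(0,0), (6,12), (12,0)]"];
      (simp add: numeric_simps)?; auto)

lemma [inside_codes]: "inside_code [True, True, False, False, True, True, False, True, False, False]"
  by (rule inside_codeI[where ps = "[(0,0), (12,0), (6,12), (10,8), (3,1)]"
        and ch = "[(0,0), (1,2), (3,1), (5,9), (10,0)]"
        and cyc = "[(0,0), (6,12), (12,0)]"];
      (simp add: numeric_simps)?; auto)

lemma [inside_codes]: "inside_code [True, True, False, True, True, False, False, False, True, True]"
  by (rule inside_codeI[where ps = "[(0,0), (12,0), (6,12), (3,1), (0,8)]"
        and ch = "[(0,0), (2,1), (3,1), (4,8), (9,0)]"
        and cyc = "[(0,0), (6,12), (12,0)]"];
      (simp add: numeric_simps)?; auto)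

lemma [inside_codes]: "inside_code [True, True, True, False, True, True, False, True, False, False]"
  by (rule inside_codeI[where ps = "[(0,0), (12,0), (6,12), (14,-2), (8,3)]"
        and ch = "[(0,0), (6,6), (7,9), (8,3), (9,4), (12,0)]"
        and cyc = "[(0,0), (6,12), (12,0)]"];
      (simp add: numeric_simps)?; auto)

lemma [inside_codes]: "inside_code [True, True, True, False, True, True, False, True, False, True]"
  by (rule inside_codeI[where ps = "[(0,0), (12,0), (6,12), (5,9), (3,1)]"
        and ch = "[(0,0), (2,1), (3,1), (5,9), (12,0)]"
        and cyc = "[(0,0), (6,12), (12,0)]"];
      (simp add: numeric_simps)?; auto)

lemma [inside_codes]: "inside_code [True, True, False, False, True, False, False, True, True, False]"
  by (rule inside_codeI[where ps = "[(0,0), (12,0), (6,12), (3,2), (5,1)]"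
        and ch = "[(0,0), (2,2), (4,2), (5,1), (6,12), (11,0)]"
        and cyc = "[(0,0), (6,12), (12,0)]"];
      (simp add: numeric_simps)?; auto)

lemma [inside_codes]: "inside_code [True, True, False, False, True, False, False, True, True, True]"
  by (rule inside_codeI[where ps = "[(0,0), (12,0), (6,12), (2,1), (3,1)]"
        and ch = "[(0,0), (1,1), (10,1), (12,0)]"
        and cyc = "[(0,0), (6,12), (12,0)]"];
      (simp add: numeric_simps)?; auto)

lemma [inside_codes]: "inside_code [True, True, False, False, True, True, False, False, True, False]"
  by (rule inside_codeI[where ps = "[(0,0), (12,0), (6,12), (9,1), (5,1)]"
        and ch = "[(1,0), (3,3), (5,1), (7,9), (9,0)]"
        and cyc = "[(0,0), (6,12), (12,0)]"];
      (simp add: numeric_simps)?; auto)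

text \<open>A triangle and a four-cycle with a common edge. The four-cycle encloses the obstacle,
  and the apex (2,-1) of the triangle hangs below the base.\<close>

lemma [inside_codes]: "inside_code [True, True, False, False, True, False, True, True, False, True]"
  by (rule inside_codeI[where ps = "[(2,-1), (0,0), (12,0), (9,2), (2,2)]"
        and ch = "[(0,0), (6,2), (9,0)]"
        and cyc = "[(0,0), (2,2), (9,2), (12,0)]"];
      (simp add: numeric_simps)?; auto)

lemma [inside_codes]: "inside_code [True, True, True, False, True, True, True, False, False, False]"
  by (rule inside_codeI[where ps = "[(0,0), (12,0), (6,12), (5,-2), (8,7)]"
        and ch = "[(0,0), (7,10), (10,0)]"
        and cyc = "[(0,0), (6,12), (12,0)]"];
      (simp add: numeric_simps)?; auto)

lemma [inside_codes]: "inside_code [True, True, False, True, True, True, True, False, False, True]"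
  by (rule inside_codeI[where ps = "[(0,0), (12,0), (6,12), (9,2), (10,-1)]"
        and ch = "[(0,0), (8,8), (9,0)]"
        and cyc = "[(0,0), (6,12), (12,0)]"];
      (simp add: numeric_simps)?; auto)

lemma [inside_codes]: "inside_code [True, True, False, True, True, True, False, True, False, False]"
  by (rule inside_codeI[where ps = "[(0,0), (12,0), (6,12), (8,5), (2,2)]"
        and ch = "[(2,0), (4,8), (10,0)]"
        and cyc = "[(0,0), (6,12), (12,0)]"];
      (simp add: numeric_simps)?; auto)

text \<open>The enclosing cycle visits all five points. It is reflex at (6,2), so the chord from
  (1,2) to (8,3) passes above the region.\<close>

lemma [inside_codes]: "inside_code [True, True, False, True, True, False, True, True, False, True]"
  by (rule inside_codeI[where ps = "[(6,2), (8,3), (1,2), (0,0), (12,0)]"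
        and ch = "[(0,0), (2,2), (12,0)]"
        and cyc = "[(0,0), (1,2), (6,2), (8,3), (12,0)]"];
      (simp add: numeric_simps)?; auto)

lemma [inside_codes]: "inside_code [True, True, True, True, True, False, True, False, True, False]"
  by (rule inside_codeI[where ps = "[(0,0), (12,0), (6,12), (2,1), (6,11)]"
        and ch = "[(0,0), (2,1), (4,7), (12,0)]"
        and cyc = "[(0,0), (6,12), (12,0)]"];
      (simp add: numeric_simps)?; auto)

lemma [inside_codes]: "inside_code [True, True, True, False, True, True, True, True, False, True]"
  by (rule inside_codeI[where ps = "[(0,0), (12,0), (6,12), (9,14), (10,3)]"
        and ch = "[(0,0), (8,8), (10,0)]"
        and cyc = "[(0,0), (6,12), (12,0)]"];
      (simp add: numeric_simps)?; auto)

lemma [inside_codes]: "inside_code [True, True, False, False, True, True, True, True, True, False]"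
  by (rule inside_codeI[where ps = "[(0,0), (12,0), (6,12), (4,5), (6,2)]"
        and ch = "[(0,0), (3,4), (5,4), (6,1), (12,0)]"
        and cyc = "[(0,0), (6,12), (12,0)]"];
      (simp add: numeric_simps)?; auto)

lemma [inside_codes]: "inside_code [True, True, False, False, True, True, True, True, True, True]"
  by (rule inside_codeI[where ps = "[(0,0), (12,0), (6,12), (11,1), (7,1)]"
        and ch = "[(0,0), (3,1), (9,0)]"
        and cyc = "[(0,0), (6,12), (12,0)]"];
      (simp add: numeric_simps)?; auto)

lemma [inside_codes]: "inside_code [True, True, False, True, True, True, False, True, True, False]"
  by (rule inside_codeI[where ps = "[(0,0), (12,0), (6,12), (6,2), (-1,1)]"
        and ch = "[(0,0), (2,2), (9,0)]"
        and cyc = "[(0,0), (6,12), (12,0)]"];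
      (simp add: numeric_simps)?; auto)

lemma [inside_codes]: "inside_code [True, True, True, False, True, False, True, True, True, True]"
  by (rule inside_codeI[where ps = "[(0,0), (12,0), (6,12), (0,2), (6,5)]"
        and ch = "[(0,0), (2,3), (9,0)]"
        and cyc = "[(0,0), (6,12), (12,0)]"];
      (simp add: numeric_simps)?; auto)

lemma [inside_codes]: "inside_code [True, True, True, False, True, True, True, True, True, False]"
  by (rule inside_codeI[where ps = "[(0,0), (12,0), (6,12), (-1,-1), (4,3)]"
        and ch = "[(0,0), (2,2), (11,0)]"
        and cyc = "[(0,0), (6,12), (12,0)]"];
      (simp add: numeric_simps)?; auto)

lemma [inside_codes]: "inside_code [True, True, True, False, True, True, True, True, True, True]"
  by (rule inside_codeI[where ps = "[(0,0), (12,0), (6,12), (1,1), (9,1)]"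
        and ch = "[(0,0), (1,1), (9,0)]"
        and cyc = "[(0,0), (6,12), (12,0)]"];
      (simp add: numeric_simps)?; auto)

lemma [inside_codes]: "inside_code [True, True, True, True, True, True, True, True, True, False]"
  by (rule inside_codeI[where ps = "[(0,0), (12,0), (6,12), (14,-2), (2,3)]"
        and ch = "[(0,0), (2,3), (10,0)]"
        and cyc = "[(0,0), (6,12), (12,0)]"];
      (simp add: numeric_simps)?; auto)

lemma [inside_codes]: "inside_code [True, True, True, True, True, True, True, True, True, True]"
  by (rule inside_codeI[where ps = "[(0,0), (12,0), (6,12), (1,1), (5,8)]"
        and ch = "[(0,0), (1,1), (9,0)]"
        and cyc = "[(0,0), (6,12), (12,0)]"];
      (simp add: numeric_simps)?; auto)

lemma [inside_codes]: "inside_code [True, False, False, True, True, False, False, True, False, True]"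
  by (rule inside_codeI[where ps = "[(0,0), (2,3), (8,4), (11,4), (12,0)]"
        and ch = "[(0,0), (2,3), (10,4), (12,0)]"
        and cyc = "[(0,0), (2,3), (8,4), (11,4), (12,0)]"];
      (simp add: numeric_simps)?; auto)

text \<open>The base of the obstacle stops at (9,0), which leaves the pendant edge from (9,1) to
  (12,0) free.\<close>

lemma [inside_codes]: "inside_code [True, False, True, True, True, False, False, True, False, False]"
  by (rule inside_codeI[where ps = "[(12,0), (0,0), (2,6), (6,6), (9,1)]"
        and ch = "[(0,0), (3,4), (8,4), (9,0)]"
        and cyc = "[(0,0), (2,6), (6,6), (12,0)]"];
      (simp add: numeric_simps)?; auto)

lemma [inside_codes]: "inside_code [True, False, True, False, True, False, False, True, False, False]"
  by (rule inside_codeI[where ps = "[(0,0), (1,8), (10,5), (12,0), (3,2)]"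
        and ch = "[(0,0), (1,8), (2,7), (3,2), (6,5), (12,0)]"
        and cyc = "[(0,0), (1,8), (10,5), (12,0)]"];
      (simp add: numeric_simps)?; auto)

section \<open>The graph $K_{2,3}$ and the other graphs with a cycle\<close>

lemma graph_iso_sym:
  assumes "graph_iso V E W F"
  shows "graph_iso W F V E"
proof -
  obtain f where f: "bij_betw f V W" and E: "\<And>u v. u \<in> V \<Longrightarrow> v \<in> V \<Longrightarrow> E u v \<longleftrightarrow> F (f u) (f v)"
    using assms by (auto simp: graph_iso_def)
  have "inv_into V f w \<in> V" "f (inv_into V f w) = w" if "w \<in> W" for w
    using f that by (auto simp: bij_betw_def inv_into_into f_inv_into_f)
  then show ?thesis
    unfolding graph_iso_def using bij_betw_inv_into[OF f] E by (intro exI[of _ "inv_into V f"]) auto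
qed

lemma graph_iso_trans:
  assumes "graph_iso V E W F" "graph_iso W F X G"
  shows "graph_iso V E X G"
proof -
  obtain f g where f: "bij_betw f V W" "\<And>u v. u \<in> V \<Longrightarrow> v \<in> V \<Longrightarrow> E u v \<longleftrightarrow> F (f u) (f v)"
    and g: "bij_betw g W X" "\<And>u v. u \<in> W \<Longrightarrow> v \<in> W \<Longrightarrow> F u v \<longleftrightarrow> G (g u) (g v)"
    using assms by (auto simp: graph_iso_def)
  have "f u \<in> W" if "u \<in> V" for u using f(1) that by (auto simp: bij_betw_def)
  then show ?thesis
    unfolding graph_iso_def using bij_betw_trans[OF f(1) g(1)] f(2) g(2)
    by (intro exI[of _ "g \<circ> f"]) auto
qed

section \<open>The outside representation of K_{2,3}\<close>

lemma hump_outside_above: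
  assumes "\<And>x. x \<in> D \<Longrightarrow> pl ch (x$1) \<le> x$2"
  shows "hump (pl ch) \<subseteq> outside D"
proof
  fix p assume "p \<in> hump (pl ch)"
  then have p: "p$2 < pl ch (p$1)" by (simp add: hump_def)
  show "p \<in> outside D"
  proof (rule ray_in_outside)
    \<comment> \<open>The ray goes straight down: it stays below the profile and so avoids
      \<open>D\<close>.\<close>
    show "vector [0, -1] \<noteq> (0 :: point)" by (simp add: point_eq_iff)
    show "p + s *\<^sub>R vector [0, -1] \<notin> D" if "0 \<le> s" for s
      using assms[of "p + s *\<^sub>R vector [0, -1]"] p that by auto
  qed
qed

lemma K23_V_eq: "K23_V = set [0, 1, 2, 3, 4]"
  by (auto simp: K23_V_def)

lemma K23_outside_obstacle_rep: "\<exists>P C. outside_obstacle_rep K23_V K23_E P C"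
proof -
  \<comment> \<open>All five points are vertices of \<open>ch\<close>, hence on the frontier of the
    region; the first two form the smaller class. The vertices (2,15), (12,4) and (16,5) lie above
    the midpoints of three of the non-edges, and (14,4) lies above the midpoint of the
    fourth.\<close>
  define ps ch :: "(real \<times> real) list"
    where "ps = [(4,8), (0,20), (10,2), (14,4), (18,5)]"
      and "ch = [(-1,0), (0,20), (2,15), (4,8), (10,2), (12,4), (14,4), (16,5), (18,5), (19,0)]"
  let ?C = "hump (pl ch)" and ?P = "set (map pt ps)"
  have ps: "distinct ps" "gp_list ps" by (simp_all add: ps_def)
  have ch: "hump_chain ch" by (simp add: ch_def hump_chain_def)
  have above: "0 < snd p" "pl ch (fst p) \<le> snd p" if "p \<in> set ps" for p
    using that by (auto simp: ps_def ch_def)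
  have hits: "list_all2 (\<lambda>b (p, q). if b then clear ch p q else midpoint_hit ch p q)
      (adj_code K23_E [0, 1, 2, 3, 4]) (pairs ps)"
    by (simp add: ps_def ch_def K23_E_def numeric_simps; auto)
  have code: "adj_code (visible ?C) (map pt ps) = adj_code K23_E [0, 1, 2, 3, 4]"
    by (rule adj_code_visible_hump[OF ps(1) hits])
  have inj: "inj pt" by (auto simp: inj_on_def point_eq_iff prod_eq_iff)
  have "distinct (map pt ps)" using ps(1) inj by (auto simp: distinct_map intro: inj_on_subset)
  then have "graph_iso K23_V K23_E ?P (visible ?C)"
    unfolding K23_V_eq using code
    by (intro graph_iso_adj_code) (auto simp: ps_def K23_E_def visible_def closed_segment_commute)
  moreover have "?P \<inter> ?C = {}"
    using above(2) by (fastforce simp: hump_def)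
  moreover have "pl ch (x$1) \<le> x$2" if x: "x \<in> vis_drawing ?P ?C" for x
  proof -
    consider p where "p \<in> set ps" "x = pt p"
      | p q where "p \<in> set ps" "q \<in> set ps" "visible ?C (pt p) (pt q)" "x \<in> closed_segment (pt p) (pt q)"
      using x by (auto simp: vis_drawing_def)
    then show ?thesis
    proof cases
      case 1
      then show ?thesis using above by simp
    next
      case 2
      then obtain t where t: "0 \<le> t" "t \<le> 1" "x = (1 - t) *\<^sub>R pt p + t *\<^sub>R pt q"
        unfolding closed_segment_def by blast
      have "x$2 = (1 - t) * snd p + t * snd q" by (simp add: t(3))
      \<comment> \<open>The drawing has positive height throughout, so a point of it that avoids the
        hump must be on or above the profile.\<close>
      moreover have "0 < (1 - t) * snd p + t * snd q"
        using t above(1)[OF 2(1)] above(1)[OF 2(2)]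
        by (cases "t = 0") (auto intro!: add_nonneg_pos)
      ultimately show ?thesis using 2 by (auto simp: visible_def hump_def not_less)
    qed
  qed
  then have "?C \<subseteq> outside (vis_drawing ?P ?C)" by (rule hump_outside_above)
  ultimately have "outside_obstacle_rep K23_V K23_E ?P ?C"
    using obstacle_hump[OF ch] general_position_gp_list[OF ps(2)]
    by (simp add: outside_obstacle_rep_def single_obstacle_rep_def)
  then show ?thesis by blast
qed

lemma has_cycle_graph_iso_K23:
  assumes "graph_iso V E K23_V K23_E"
  shows "has_cycle V E"
proof -
  obtain g where g: "bij_betw g K23_V V" "\<And>i j. i \<in> K23_V \<Longrightarrow> j \<in> K23_V \<Longrightarrow> K23_E i j \<longleftrightarrow> E (g i) (g j)"
    using graph_iso_sym[OF assms] by (auto simp: graph_iso_def)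
  have "distinct (map g [0, 2, 1, 3])" "set (map g [0, 2, 1, 3]) \<subseteq> V"
    using g(1) by (auto simp: bij_betw_def K23_V_eq inj_on_def)
  moreover have "E (map g [0, 2, 1, 3] ! i) (map g [0, 2, 1, 3] ! ((i + 1) mod 4))" if "i < 4" for i
  proof -
    have "i \<in> {0, 1, 2, 3}" using that by auto
    moreover have "E (g 0) (g 2)" "E (g 2) (g 1)" "E (g 1) (g 3)" "E (g 3) (g 0)"
      using g(2)[of 0 2] g(2)[of 2 1] g(2)[of 1 3] g(2)[of 3 0] by (simp_all add: K23_V_eq K23_E_def)
    ultimately show ?thesis by auto
  qed
  ultimately show ?thesis
    unfolding has_cycle_def by (intro exI[of _ "map g [0, 2, 1, 3]"]) simp
qed

section \<open>Five-vertex graphs without an inside representation\<close>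

context
  fixes V :: "'a set" and E :: "'a \<Rightarrow> 'a \<Rightarrow> bool"
  assumes g: "graph V E" and card: "card V = 5"
    and no_inside: "\<not> (\<exists>P C. inside_obstacle_rep V E P C)"
begin

lemma edge_sym: "E u v \<longleftrightarrow> E v u" and edge_irrefl: "\<not> E u u" and finite_vertices: "finite V"
  using g by (auto simp: graph_def)

lemma distinct_covers_V: "distinct vs \<Longrightarrow> set vs \<subseteq> V \<Longrightarrow> length vs = 5 \<Longrightarrow> set vs = V"
  using card finite_vertices by (metis card_subset_eq distinct_card)

lemma not_inside_code: "distinct vs \<Longrightarrow> set vs \<subseteq> V \<Longrightarrow> length vs = 5 \<Longrightarrow> \<not> inside_code (adj_code E vs)"
  using inside_rep_of_adj_code[OF g] distinct_covers_V no_inside by metis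

text \<open>The triangle can be listed first in twelve orders. For each truth assignment to the
  other seven pairs, at least one order yields the code of an example.\<close>

lemma no_triangle:
  assumes "E a b" "E b c"
  shows "\<not> E a c"
proof
  assume "E a c"
  have ne: "a \<noteq> b" "b \<noteq> c" "a \<noteq> c" using assms \<open>E a c\<close> edge_irrefl by auto
  have V: "a \<in> V" "b \<in> V" "c \<in> V" using assms g by (auto simp: graph_def)
  have "card (V - {a, b, c}) = 2" using ne V finite_vertices card by (simp add: card_Diff_subset)
  then obtain d e where de: "V - {a, b, c} = {d, e}" "d \<noteq> e" by (meson card_2_iff)
  then have mem: "d \<in> V" "e \<in> V" "a \<noteq> d" "b \<noteq> d" "c \<noteq> d" "a \<noteq> e" "b \<noteq> e" "c \<noteq> e" by auto
  \<comment> \<open>Orients every pair alike, so that the codes of different orders speak about the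
    same ten atoms.\<close>
  have eqs: "E b a = E a b" "E c a = E a c" "E c b = E b c" "E d a = E a d" "E d b = E b d" "E d c = E c d"
    "E e a = E a e" "E e b = E b e" "E e c = E c e" "E e d = E d e"
    using edge_sym by auto
  have N: "\<not> inside_code (adj_code E [x, y, z, d, e])" "\<not> inside_code (adj_code E [x, y, z, e, d])"
    if "distinct [x, y, z]" "{x, y, z} = {a, b, c}" for x y z
    by (rule not_inside_code; use that ne mem V de(2) in auto)+
  note N' = N[of a b c] N[of a c b] N[of b a c] N[of b c a] N[of c a b] N[of c b a]
  have perms: "{a, c, b} = {a, b, c}" "{b, a, c} = {a, b, c}" "{b, c, a} = {a, b, c}"
    "{c, a, b} = {a, b, c}" "{c, b, a} = {a, b, c}" by auto
  show False
    using N' assms \<open>E a c\<close> ne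
    by (simp add: perms eqs)
      (cases "E a d"; cases "E b d"; cases "E c d"; cases "E a e"; cases "E b e"; cases "E c e";
        cases "E d e"; simp add: inside_codes)
qed

lemma four_cycle_imp_K23:
  assumes "distinct [a, b, c, d]" "{a, b, c, d} \<subseteq> V" "E a b" "E b c" "E c d" "E d a"
  shows "graph_iso V E K23_V K23_E"
proof (rule ccontr)
  assume K: "\<not> graph_iso V E K23_V K23_E"
  have "card (V - {a, b, c, d}) = 1" using assms finite_vertices card by (simp add: card_Diff_subset)
  then obtain e where e: "V - {a, b, c, d} = {e}" by (meson card_1_singletonE)
  then have mem: "e \<in> V" "a \<noteq> e" "b \<noteq> e" "c \<noteq> e" "d \<noteq> e" by auto
  have code_ne: "adj_code E vs \<noteq> adj_code K23_E [0, 1, 2, 3, 4]" if "distinct vs" "set vs \<subseteq> V" "length vs = 5" for vs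
  proof
    assume "adj_code E vs = adj_code K23_E [0, 1, 2, 3, 4]"
    then have "graph_iso (set vs) E (set [0, 1, 2, 3, 4]) K23_E"
      using that edge_sym edge_irrefl by (intro graph_iso_adj_code) (auto simp: K23_E_def)
    then show False using K distinct_covers_V[OF that] by (simp add: K23_V_eq)
  qed
  have eqs: "E b a = E a b" "E c a = E a c" "E c b = E b c" "E d a = E a d" "E d b = E b d" "E d c = E c d"
    "E e a = E a e" "E e b = E b e" "E e c = E c e" "E e d = E d e"
    using edge_sym by auto
  have diag: "\<not> E a c" "\<not> E b d"
    using no_triangle[of a b c] no_triangle[of b c d] assms by auto
  have "\<not> (E a e \<and> E b e)" "\<not> (E b e \<and> E c e)" "\<not> (E c e \<and> E d e)" "\<not> (E d e \<and> E a e)"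
    using no_triangle[of b a e] no_triangle[of c b e] no_triangle[of d c e] no_triangle[of a d e] assms eqs
    by auto
  \<comment> \<open>Without triangles \<open>e\<close> has no two consecutive neighbours on the
    cycle: it has none, one, or two opposite ones.\<close>
  then consider "\<not> E a e" "\<not> E b e" "\<not> E c e" "\<not> E d e"
    | "E a e" "\<not> E b e" "\<not> E c e" "\<not> E d e" | "\<not> E a e" "E b e" "\<not> E c e" "\<not> E d e"
    | "\<not> E a e" "\<not> E b e" "E c e" "\<not> E d e" | "\<not> E a e" "\<not> E b e" "\<not> E c e" "E d e"
    | "E a e" "\<not> E b e" "E c e" "\<not> E d e" | "\<not> E a e" "E b e" "\<not> E c e" "E d e"
    by blast
  \<comment> \<open>Rotating the cycle brings a single neighbour of \<open>e\<close> to the front,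
    as the example with a pendant vertex expects.\<close>
  moreover have "\<not> inside_code (adj_code E [a, b, c, d, e])" "\<not> inside_code (adj_code E [b, c, d, a, e])"
    "\<not> inside_code (adj_code E [c, d, a, b, e])" "\<not> inside_code (adj_code E [d, a, b, c, e])"
    by (rule not_inside_code; use assms mem in auto)+
  \<comment> \<open>If \<open>e\<close> is joined to \<open>a\<close> and \<open>c\<close>, these
    two have degree three and correspond to the vertices 0 and 1 of K_{2,3}; likewise for
    \<open>b\<close> and \<open>d\<close>.\<close>
  moreover have "adj_code E [a, c, b, d, e] \<noteq> adj_code K23_E [0, 1, 2, 3, 4]"
    "adj_code E [b, d, a, c, e] \<noteq> adj_code K23_E [0, 1, 2, 3, 4]"
    by (rule code_ne; use assms mem in auto)+
  ultimately show False
    using assms(3-6) diag by cases (simp_all add: eqs K23_E_def inside_codes)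
qed

lemma no_five_cycle:
  assumes "distinct [a, b, c, d, e]" "{a, b, c, d, e} \<subseteq> V" "E a b" "E b c" "E c d" "E d e" "E e a"
  shows False
proof -
  \<comment> \<open>Each chord of a five-cycle cuts off a triangle.\<close>
  have "\<not> E a c" "\<not> E b d" "\<not> E c e" "\<not> E a d" "\<not> E b e" "E a e"
    using no_triangle[of a b c] no_triangle[of b c d] no_triangle[of c d e] no_triangle[of d e a]
      no_triangle[of e a b] assms edge_sym by blast+
  then show False
    using not_inside_code[of "[a, b, c, d, e]"] assms by (simp add: inside_codes)
qed

lemma cycle_imp_K23:
  assumes "has_cycle V E"
  shows "graph_iso V E K23_V K23_E"
proof -
  obtain vs where vs: "length vs \<ge> 3" "distinct vs" "set vs \<subseteq> V"
    and E: "\<And>i. i < length vs \<Longrightarrow> E (vs ! i) (vs ! ((i + 1) mod length vs))"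
    using assms by (auto simp: has_cycle_def)
  have "length vs \<le> 5" using vs card finite_vertices by (metis card_mono distinct_card)
  then consider "length vs = 3" | "length vs = 4" | "length vs = 5" using vs(1) by linarith
  then show ?thesis
  proof cases
    case 1
    then obtain a b c where "vs = [a, b, c]" by (auto simp: numeral_eq_Suc length_Suc_conv)
    then have "E a b" "E b c" "E c a" using E[of 0] E[of 1] E[of 2] by auto
    then show ?thesis using no_triangle[of a b c] edge_sym by blast
  next
    case 2
    then obtain a b c d where "vs = [a, b, c, d]" by (auto simp: numeral_eq_Suc length_Suc_conv)
    moreover from this have "E a b" "E b c" "E c d" "E d a" using E[of 0] E[of 1] E[of 2] E[of 3] by auto
    ultimately show ?thesis using four_cycle_imp_K23[of a b c d] vs by simp
  next
    case 3
    then obtain a b c d e where "vs = [a, b, c, d, e]" by (auto simp: numeral_eq_Suc length_Suc_conv)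
    moreover from this have "E a b" "E b c" "E c d" "E d e" "E e a"
      using E[of 0] E[of 1] E[of 2] E[of 3] E[of 4] by auto
    ultimately show ?thesis using no_five_cycle[of a b c d e] vs by simp
  qed
qed

end

theorem theorem8:
  fixes V :: "'a set" and E :: "'a \<Rightarrow> 'a \<Rightarrow> bool"
  assumes "graph V E" and "card V = 5"
  shows "(has_cycle V E \<and> (\<exists>P C. outside_obstacle_rep V E P C) \<and> \<not> (\<exists>P C. inside_obstacle_rep V E P C))
         \<longleftrightarrow> graph_iso V E K23_V K23_E"
proof
  assume "has_cycle V E \<and> (\<exists>P C. outside_obstacle_rep V E P C) \<and> \<not> (\<exists>P C. inside_obstacle_rep V E P C)"
  then show "graph_iso V E K23_V K23_E" using cycle_imp_K23[OF assms] by blast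
next
  assume iso: "graph_iso V E K23_V K23_E"
  obtain P C where "outside_obstacle_rep K23_V K23_E P C" using K23_outside_obstacle_rep by blast
  then have "outside_obstacle_rep V E P C"
    using graph_iso_trans[OF iso] by (auto simp: outside_obstacle_rep_def single_obstacle_rep_def)
  moreover have "\<not> inside_obstacle_rep V E P C" for P C
    using K23_no_inside_obstacle_rep[of P C] graph_iso_trans[OF graph_iso_sym[OF iso]]
    by (auto simp: inside_obstacle_rep_def single_obstacle_rep_def)
  ultimately show "has_cycle V E \<and> (\<exists>P C. outside_obstacle_rep V E P C) \<and> \<not> (\<exists>P C. inside_obstacle_rep V E P C)"
    using has_cycle_graph_iso_K23[OF iso] by blast
qed

end
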